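(* (Cyclic Extension Theorem.) Each extension type determines a group: if $N$ is a group and $(N,n,\tau,v)$ is an extension type for $N$, then there exists a group $G$ that realizes $(N,n,\tau,v)$.
   Context: For $v$ in a group $N$, $\operatorname{Int}(v)$ is the automorphism $x\mapsto vxv^{-1}$ of $N$. An extension type for a group $N$ is a quadruple $(N,n,\tau,v)$ where $n$ is a positive integer, $\tau\in\operatorname{Aut}(N)$, and $v\in N$ satisfies $\tau(v)=v$ and $\tau^n=\operatorname{Int}(v)$. A group $G$ realizes $(N,n,\tau,v)$ if there are a normal subgroup $N'$ of $G$ with $G/N'$ cyclic of order $n$, an element $a\in G$ whose coset generates $G/N'$, and an isomorphism $\phi:N\to N'$ such that $a^n=\phi(v)$ and $a\phi(y)a^{-1}=\phi(\tau(y))$ for all $y\in N$. *)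

theory Defs
  imports "HOL-Algebra.Bij" "HOL-Algebra.Elementary_Groups"
begin

text \<open>Elements of \<^term>\<open>AutoGroup N\<close> are extensional functions, so conjugation is restricted to the carrier.\<close>

definition inner_aut :: "('a, 'b) monoid_scheme \<Rightarrow> 'a \<Rightarrow> 'a \<Rightarrow> 'a"
  where "inner_aut N v = (\<lambda>x\<in>carrier N. v \<otimes>\<^bsub>N\<^esub> x \<otimes>\<^bsub>N\<^esub> inv\<^bsub>N\<^esub> v)"

definition extension_type ::
    "('a, 'b) monoid_scheme \<Rightarrow> nat \<Rightarrow> ('a \<Rightarrow> 'a) \<Rightarrow> 'a \<Rightarrow> bool"
  where "extension_type N n \<tau> v \<longleftrightarrow>
    group N \<and> n > 0 \<and> \<tau> \<in> carrier (AutoGroup N) \<and> v \<in> carrier N \<and>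
    \<tau> v = v \<and> \<tau> [^]\<^bsub>AutoGroup N\<^esub> n = inner_aut N v"

definition realizes ::
    "('g, 'c) monoid_scheme \<Rightarrow> ('a, 'b) monoid_scheme \<Rightarrow> nat \<Rightarrow> ('a \<Rightarrow> 'a) \<Rightarrow> 'a \<Rightarrow> bool"
  where "realizes G N n \<tau> v \<longleftrightarrow>
    group G \<and>
    (\<exists>N' a \<phi>. N' \<lhd> G \<and>
      cyclic_group (G Mod N') \<and> order (G Mod N') = n \<and>
      a \<in> carrier G \<and> generate (G Mod N') {N' #>\<^bsub>G\<^esub> a} = carrier (G Mod N') \<and>
      \<phi> \<in> iso N (G\<lparr>carrier := N'\<rparr>) \<and>
      a [^]\<^bsub>G\<^esub> n = \<phi> v \<and>
      (\<forall>y\<in>carrier N. a \<otimes>\<^bsub>G\<^esub> \<phi> y \<otimes>\<^bsub>G\<^esub> inv\<^bsub>G\<^esub> a = \<phi> (\<tau> y)))"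

end

theory Submission
  imports Defs
begin

text \<open>
  If a group realizes \<open>(N, n, \<tau>, v)\<close>, each of its elements is uniquely \<open>x a\<^sup>i\<close> with \<open>x\<close> in \<open>N\<close> and
  \<open>0 \<le> i < n\<close>, and the relations \<open>a y a\<inverse> = \<tau> y\<close>, \<open>a\<^sup>n = v\<close> force
  \<open>(x a\<^sup>i) (y a\<^sup>j) = x \<tau>\<^sup>i(y) a\<^bsup>i+j\<^esup>\<close>, where \<open>a\<^bsup>k\<^esup> = v\<^bsup>k div n\<^esup> a\<^bsup>k mod n\<^esup>\<close>. The proof takes this as
  the definition of a multiplication on the pairs \<open>(x, i)\<close>. Writing the carry as a power of \<open>v\<close> with
  exponent \<open>(i + j) div n\<close>, rather than by distinguishing \<open>i + j < n\<close> from \<open>i + j \<ge> n\<close>, makes the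
  verification uniform.

  The one identity behind everything is \<open>v\<^sup>q \<tau>\<^sup>r(z) = \<tau>\<^bsup>r+qn\<^esup>(z) v\<^sup>q\<close> (lemma \<open>pow_twist\<close>), a restatement
  of \<open>\<tau>\<^sup>n = Int(v)\<close>: it lets carries move to the right past elements of \<open>N\<close>. Carries also occur
  inside an argument of \<open>\<tau>\<^sup>i\<close>, which leaves them unchanged because \<open>\<tau> v = v\<close>. Thus both ways of bracketing
  \<open>(x, i) (y, j) (z, k)\<close> become \<open>x \<tau>\<^sup>i(y) \<tau>\<^bsup>i+j\<^esup>(z) v\<^sup>m\<close> with \<open>m = (i + j + k) div n\<close>. The second
  components add modulo \<open>n\<close>, so projection to them is a homomorphism onto \<open>\<int>/n\<close>; its kernel is the copy
  of \<open>N\<close>, and the quotient is therefore cyclic of order \<open>n\<close>.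
\<close>

section \<open>Powers of the twisting automorphism\<close>

text \<open>
  The hypotheses in pointwise form, with iterates of \<open>\<tau>\<close> as plain functions, so that the arithmetic
  needs no extensionality bookkeeping.
\<close>

locale cyclic_extension = group N for N (structure) +
  fixes n :: nat and \<tau> :: "'a \<Rightarrow> 'a" and v :: 'a
  assumes n_pos: "n > 0"
    and tau_hom: "\<tau> \<in> hom N N"
    and v_closed [simp, intro]: "v \<in> carrier N"
    and tau_fix: "\<tau> v = v"
    and tau_pow_n: "x \<in> carrier N \<Longrightarrow> (\<tau> ^^ n) x = v \<otimes> x \<otimes> inv v"

lemma AutoGroup_pow_apply:
  assumes "\<tau> \<in> carrier (AutoGroup N)" and "x \<in> carrier N"
  shows "(\<tau> [^]\<^bsub>AutoGroup N\<^esub> (k::nat)) x = (\<tau> ^^ k) x"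
proof -
  have tau_Bij: "\<tau> \<in> Bij (carrier N)"
    using assms(1) by (simp add: AutoGroup_def auto_def)
  \<comment> \<open>the product of \<^term>\<open>BijGroup\<close> is composition only on bijections, so the induction carries membership\<close>
  have "\<tau> [^]\<^bsub>AutoGroup N\<^esub> k \<in> Bij (carrier N) \<and>
      (\<forall>x \<in> carrier N. (\<tau> [^]\<^bsub>AutoGroup N\<^esub> k) x = (\<tau> ^^ k) x)"
  proof (induction k)
    case 0
    have "\<tau> [^]\<^bsub>AutoGroup N\<^esub> (0::nat) = restrict (\<lambda>x. x) (carrier N)"
      unfolding nat_pow_0 by (simp add: AutoGroup_def BijGroup_def)
    with assms(2) show ?case
      by (simp only: id_Bij) simp
  next
    case (Suc k)
    have "\<tau> [^]\<^bsub>AutoGroup N\<^esub> Suc k = compose (carrier N) (\<tau> [^]\<^bsub>AutoGroup N\<^esub> k) \<tau>"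
      using Suc.IH tau_Bij by (simp add: AutoGroup_def BijGroup_def)
    with Suc.IH show ?case
      using tau_Bij funcset_mem[OF Bij_imp_funcset[OF tau_Bij]]
      by (simp add: compose_Bij compose_eq funpow_swap1)
  qed
  with assms(2) show ?thesis by blast
qed

lemma cyclic_extension_of_extension_type:
  assumes "extension_type N n \<tau> v"
  shows "cyclic_extension N n \<tau> v"
proof -
  have ext: "group N" "n > 0" "\<tau> \<in> carrier (AutoGroup N)" "v \<in> carrier N" "\<tau> v = v"
    "\<tau> [^]\<^bsub>AutoGroup N\<^esub> n = inner_aut N v"
    using assms by (auto simp: extension_type_def)
  show ?thesis
  proof (intro cyclic_extension.intro cyclic_extension_axioms.intro)
    show "\<tau> \<in> hom N N"
      using ext(3) by (simp add: AutoGroup_def auto_def)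
    show "(\<tau> ^^ n) x = v \<otimes>\<^bsub>N\<^esub> x \<otimes>\<^bsub>N\<^esub> inv\<^bsub>N\<^esub> v" if "x \<in> carrier N" for x
      using AutoGroup_pow_apply[OF ext(3) that, of n] ext(6) that by (simp add: inner_aut_def)
  qed (use ext in auto)
qed

context cyclic_extension
begin

lemma iter_hom: "(\<tau> ^^ k) \<in> hom N N"
  by (induction k) (use tau_hom in \<open>auto simp: hom_def Pi_iff\<close>)

lemma iter_closed [simp, intro]: "x \<in> carrier N \<Longrightarrow> (\<tau> ^^ k) x \<in> carrier N"
  using iter_hom by (rule hom_in_carrier)

lemma iter_mult:
  "x \<in> carrier N \<Longrightarrow> y \<in> carrier N \<Longrightarrow> (\<tau> ^^ k) (x \<otimes> y) = (\<tau> ^^ k) x \<otimes> (\<tau> ^^ k) y"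
  using iter_hom by (rule hom_mult)

lemma iter_one: "(\<tau> ^^ k) \<one> = \<one>"
  using hom_one[OF iter_hom] is_group by blast

lemma iter_v: "(\<tau> ^^ k) v = v"
  by (induction k) (auto simp: tau_fix)

lemma iter_v_pow: "(\<tau> ^^ k) (v [^] (q::nat)) = v [^] q"
  by (induction q) (auto simp: iter_one iter_mult iter_v)

lemma iter_n_twist: "z \<in> carrier N \<Longrightarrow> v \<otimes> z = (\<tau> ^^ n) z \<otimes> v"
  by (simp add: tau_pow_n m_assoc)

text \<open>
  In the group to be built, \<open>v\<^sup>q\<close> is \<open>a\<^bsup>qn\<^esup>\<close>, so moving it past an element of \<open>N\<close> applies \<open>\<tau>\<close> another
  \<open>qn\<close> times.
\<close>

lemma pow_twist:
  assumes z: "z \<in> carrier N"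
  shows "v [^] q \<otimes> (\<tau> ^^ r) z = (\<tau> ^^ (r + q * n)) z \<otimes> v [^] q"
proof (induction q)
  case 0
  show ?case using z by simp
next
  case (Suc q)
  have "v [^] Suc q \<otimes> (\<tau> ^^ r) z = v \<otimes> (v [^] q \<otimes> (\<tau> ^^ r) z)"
    using z by (simp only: nat_pow_Suc2 v_closed m_assoc nat_pow_closed iter_closed)
  also have "\<dots> = (v \<otimes> (\<tau> ^^ (r + q * n)) z) \<otimes> v [^] q"
    using z by (simp only: Suc.IH v_closed m_assoc nat_pow_closed iter_closed)
  also have "\<dots> = ((\<tau> ^^ n) ((\<tau> ^^ (r + q * n)) z) \<otimes> v) \<otimes> v [^] q"
    using z by (simp only: iter_n_twist iter_closed)
  also have "\<dots> = (\<tau> ^^ (n + (r + q * n))) z \<otimes> v [^] Suc q"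
    using z by (simp only: nat_pow_Suc2 v_closed m_assoc nat_pow_closed iter_closed funpow_add comp_apply)
  finally show ?case by (simp add: ac_simps)
qed

corollary carry_twist:
  assumes "z \<in> carrier N"
  shows "v [^] (k div n) \<otimes> (\<tau> ^^ (k mod n)) z = (\<tau> ^^ k) z \<otimes> v [^] (k div n)"
  using pow_twist[OF assms, of "k div n" "k mod n"] by simp


section \<open>The group of normal forms\<close>

text \<open>The pair \<open>(x, i)\<close> stands for the product \<open>x a\<^sup>i\<close>.\<close>

definition ext_group :: "('a \<times> nat) monoid" where
  "ext_group = \<lparr>carrier = carrier N \<times> {0..<n},
     mult = (\<lambda>(x, i) (y, j). (x \<otimes> (\<tau> ^^ i) y \<otimes> v [^] ((i + j) div n), (i + j) mod n)),
     one = (\<one>, 0)\<rparr>"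

lemma carrier_ext [simp]: "carrier ext_group = carrier N \<times> {0..<n}"
  and mult_ext [simp]: "(x, i) \<otimes>\<^bsub>ext_group\<^esub> (y, j) =
    (x \<otimes> (\<tau> ^^ i) y \<otimes> v [^] ((i + j) div n), (i + j) mod n)"
  and one_ext [simp]: "\<one>\<^bsub>ext_group\<^esub> = (\<one>, 0)"
  by (simp_all add: ext_group_def)

text \<open>
  When three exponents are added modulo \<open>n\<close>, the total carry does not depend on the bracketing; this is
  the arithmetic half of associativity.
\<close>

lemma carry_total:
  "(i + j) div n + ((i + j) mod n + k) div n = (i + j + k) div n" for i j k :: nat
proof -
  have "i + j + k = ((i + j) mod n + k) + n * ((i + j) div n)"
    using mod_mult_div_eq[of "i + j" n] by linarith
  then show ?thesis
    using n_pos by (metis add.commute div_mult_self2 less_numeral_extra(3))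
qed

lemma ext_assoc:
  assumes "x \<in> carrier N" "y \<in> carrier N" "z \<in> carrier N"
  shows "((x, i) \<otimes>\<^bsub>ext_group\<^esub> (y, j)) \<otimes>\<^bsub>ext_group\<^esub> (z, k) =
    (x, i) \<otimes>\<^bsub>ext_group\<^esub> ((y, j) \<otimes>\<^bsub>ext_group\<^esub> (z, k))"
proof -
  let ?q = "(i + j) div n" and ?q' = "((i + j) mod n + k) div n"
  let ?p = "(j + k) div n" and ?p' = "(i + (j + k) mod n) div n"
  have "x \<otimes> (\<tau> ^^ i) y \<otimes> v [^] ?q \<otimes> (\<tau> ^^ ((i + j) mod n)) z \<otimes> v [^] ?q'
      = x \<otimes> (\<tau> ^^ i) y \<otimes> (v [^] ?q \<otimes> (\<tau> ^^ ((i + j) mod n)) z) \<otimes> v [^] ?q'"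
    using assms by (simp add: m_assoc)
  also have "\<dots> = x \<otimes> (\<tau> ^^ i) y \<otimes> (\<tau> ^^ (i + j)) z \<otimes> (v [^] ?q \<otimes> v [^] ?q')"
    using assms by (simp only: carry_twist) (simp add: m_assoc)
  also have "v [^] ?q \<otimes> v [^] ?q' = v [^] ((i + j + k) div n)"
    by (simp only: nat_pow_mult v_closed carry_total)
  finally have left: "x \<otimes> (\<tau> ^^ i) y \<otimes> v [^] ?q \<otimes> (\<tau> ^^ ((i + j) mod n)) z \<otimes> v [^] ?q'
      = x \<otimes> (\<tau> ^^ i) y \<otimes> (\<tau> ^^ (i + j)) z \<otimes> v [^] ((i + j + k) div n)" .
  have "x \<otimes> (\<tau> ^^ i) (y \<otimes> (\<tau> ^^ j) z \<otimes> v [^] ?p) \<otimes> v [^] ?p'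
      = x \<otimes> (\<tau> ^^ i) y \<otimes> (\<tau> ^^ (i + j)) z \<otimes> (v [^] ?p \<otimes> v [^] ?p')"
    using assms by (simp add: iter_mult iter_v_pow m_assoc funpow_add)
  also have "v [^] ?p \<otimes> v [^] ?p' = v [^] ((i + j + k) div n)"
    using carry_total[of j k i] by (simp add: nat_pow_mult ac_simps)
  finally show ?thesis
    using left by (simp add: mod_add_left_eq mod_add_right_eq add.assoc)
qed

lemma group_ext: "group ext_group"
proof (rule groupI)
  show "\<one>\<^bsub>ext_group\<^esub> \<in> carrier ext_group"
    using n_pos by simp
next
  fix g h assume "g \<in> carrier ext_group" "h \<in> carrier ext_group"
  then show "g \<otimes>\<^bsub>ext_group\<^esub> h \<in> carrier ext_group"
    using n_pos by (cases g; cases h) simp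
next
  fix g h l
  assume "g \<in> carrier ext_group" "h \<in> carrier ext_group" "l \<in> carrier ext_group"
  then show "g \<otimes>\<^bsub>ext_group\<^esub> h \<otimes>\<^bsub>ext_group\<^esub> l = g \<otimes>\<^bsub>ext_group\<^esub> (h \<otimes>\<^bsub>ext_group\<^esub> l)"
    by (cases g; cases h; cases l) (simp only: carrier_ext mem_Times_iff fst_conv ext_assoc)
next
  fix g assume "g \<in> carrier ext_group"
  then show "\<one>\<^bsub>ext_group\<^esub> \<otimes>\<^bsub>ext_group\<^esub> g = g"
    by (cases g) simp
next
  fix g assume "g \<in> carrier ext_group"
  then obtain x i where g: "g = (x, i)" "x \<in> carrier N" "i < n"
    by (cases g) auto
  \<comment> \<open>the reduction modulo \<open>n\<close> matters only for \<open>i = 0\<close>\<close>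
  define j where "j = (n - i) mod n"
  define w where "w = (\<tau> ^^ j) x \<otimes> v [^] ((j + i) div n)"
  have w: "w \<in> carrier N" using g by (simp add: w_def)
  have "(j + i) mod n = 0"
    using g by (simp add: j_def mod_add_left_eq)
  moreover have "inv w \<otimes> (\<tau> ^^ j) x \<otimes> v [^] ((j + i) div n) = inv w \<otimes> w"
    using g w by (simp add: w_def m_assoc)
  ultimately have "(inv w, j) \<otimes>\<^bsub>ext_group\<^esub> g = \<one>\<^bsub>ext_group\<^esub>"
    using g w by simp
  moreover have "(inv w, j) \<in> carrier ext_group"
    using w n_pos by (simp add: j_def)
  ultimately show "\<exists>h\<in>carrier ext_group. h \<otimes>\<^bsub>ext_group\<^esub> g = \<one>\<^bsub>ext_group\<^esub>"
    by blast
qed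


section \<open>The copy of the kernel and the cyclic quotient\<close>

definition base :: "('a \<times> nat) set" where
  "base = carrier N \<times> {0}"

text \<open>
  The element \<open>a\<close> is the normal form of \<open>a\<^sup>1\<close>. It is \<open>(\<one>, 1)\<close> if \<open>n > 1\<close>; for \<open>n = 1\<close> there is no
  exponent \<open>1\<close>, and the formula gives \<open>(v, 0)\<close>, as \<open>a\<^sup>1 = v\<close> requires.
\<close>

definition shift :: "'a \<times> nat" where
  "shift = (v [^] (1 div n), 1 mod n)"

lemma shift_closed [simp]: "shift \<in> carrier ext_group"
  using n_pos by (simp add: shift_def)

lemma shift_pow: "shift [^]\<^bsub>ext_group\<^esub> (k::nat) = (v [^] (k div n), k mod n)"
proof (induction k)
  case 0
  show ?case by simp
next
  case (Suc k)
  interpret E: group ext_group by (rule group_ext)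
  have "k div n + 1 div n + (k mod n + 1 mod n) div n = Suc k div n"
    using div_add1_eq[of k 1 n] by simp
  then have "(v [^] (k div n), k mod n) \<otimes>\<^bsub>ext_group\<^esub> (v [^] (1 div n), 1 mod n) =
      (v [^] (Suc k div n), Suc k mod n)"
    by (simp only: mult_ext iter_v_pow nat_pow_mult v_closed) (simp only: mod_add_eq Suc_eq_plus1)
  then show ?case
    by (simp only: E.nat_pow_Suc Suc.IH) (simp only: shift_def)
qed

lemma shift_pow_n: "shift [^]\<^bsub>ext_group\<^esub> n = (v, 0)"
  using n_pos by (simp add: shift_pow)

lemma normal_form:
  assumes "x \<in> carrier N" "i < n"
  shows "(x, i) = (x, 0) \<otimes>\<^bsub>ext_group\<^esub> shift [^]\<^bsub>ext_group\<^esub> i"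
  using assms by (simp add: shift_pow)

lemma shift_conj:
  assumes y: "y \<in> carrier N"
  shows "shift \<otimes>\<^bsub>ext_group\<^esub> (y, 0) \<otimes>\<^bsub>ext_group\<^esub> inv\<^bsub>ext_group\<^esub> shift = (\<tau> y, 0)"
proof -
  interpret E: group ext_group by (rule group_ext)
  have ty: "\<tau> y \<in> carrier N" using iter_closed[OF y, of 1] by simp
  have "shift \<otimes>\<^bsub>ext_group\<^esub> (y, 0) = (\<tau> y, 0) \<otimes>\<^bsub>ext_group\<^esub> shift"
    using y ty n_pos carry_twist[OF y, of 1] by (simp add: shift_def)
  moreover have "(y, 0) \<in> carrier ext_group" "(\<tau> y, 0) \<in> carrier ext_group"
    using y ty n_pos by auto
  ultimately show ?thesis
    by (simp add: E.m_assoc del: carrier_ext mult_ext one_ext)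
qed

text \<open>
  Forgetting the first component is a homomorphism because the carry only affects that component.
\<close>

lemma exponent_hom: "group_hom ext_group (integer_mod_group n) (\<lambda>g. int (snd g))"
proof -
  have "(\<lambda>g. int (snd g)) \<in> hom ext_group (integer_mod_group n)"
    using n_pos by (auto simp: hom_def carrier_integer_mod_group zmod_int)
  then show ?thesis
    by (simp add: group_hom_def group_hom_axioms_def group_ext)
qed

lemma kernel_exponent: "kernel ext_group (integer_mod_group n) (\<lambda>g. int (snd g)) = base"
  using n_pos by (auto simp: kernel_def base_def)

lemma base_normal: "base \<lhd> ext_group"
  using group_hom.normal_kernel[OF exponent_hom] by (simp add: kernel_exponent)

lemma order_quotient: "order (ext_group Mod base) = n"
proof -
  have "(\<lambda>g. int (snd g)) ` carrier ext_group = carrier (integer_mod_group n)"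
  proof -
    have "int ` {0..<n} = {0..<int n}" by (simp add: image_int_atLeastLessThan)
    moreover have "snd ` (carrier N \<times> {0..<n}) = {0..<n}" using one_closed by force
    ultimately show ?thesis
      using n_pos by (simp add: carrier_integer_mod_group flip: image_image[of int snd])
  qed
  then have "ext_group Mod base \<cong> integer_mod_group n"
    using group_hom.FactGroup_iso[OF exponent_hom] by (simp add: kernel_exponent)
  then show ?thesis
    using n_pos iso_same_card by (fastforce simp: order_def carrier_integer_mod_group)
qed

lemma quotient_generated:
  "generate (ext_group Mod base) {base #>\<^bsub>ext_group\<^esub> shift} = carrier (ext_group Mod base)"
proof -
  interpret B: normal base ext_group by (rule base_normal)
  interpret Q: group "ext_group Mod base" by (rule B.factorgroup_is_group)
  have gen: "base #>\<^bsub>ext_group\<^esub> shift \<in> carrier (ext_group Mod base)"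
    using shift_closed by (simp add: carrier_FactGroup del: carrier_ext)
  have "X \<in> generate (ext_group Mod base) {base #>\<^bsub>ext_group\<^esub> shift}"
    if in_quotient: "X \<in> carrier (ext_group Mod base)" for X
  proof -
    obtain x i where X: "X = base #>\<^bsub>ext_group\<^esub> (x, i)" and xi: "x \<in> carrier N" "i < n"
      using in_quotient by (auto simp: carrier_FactGroup)
    have x0: "(x, 0) \<in> base" using xi by (simp add: base_def)
    have "X = (base #>\<^bsub>ext_group\<^esub> (x, 0)) #>\<^bsub>ext_group\<^esub> shift [^]\<^bsub>ext_group\<^esub> i"
      unfolding X normal_form[OF xi]
      by (intro B.coset_mult_assoc[symmetric] B.subset B.mem_carrier[OF x0] B.nat_pow_closed shift_closed)
    also have "\<dots> = base #>\<^bsub>ext_group\<^esub> shift [^]\<^bsub>ext_group\<^esub> i"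
      using x0 by (simp add: B.rcos_const[OF B.is_group] del: carrier_ext)
    also have "\<dots> = (base #>\<^bsub>ext_group\<^esub> shift) [^]\<^bsub>ext_group Mod base\<^esub> int i"
      by (simp only: B.FactGroup_pow shift_closed int_pow_int)
    finally show ?thesis
      using Q.generate_pow[OF gen] by blast
  qed
  then show ?thesis
    using Q.generate_incl[of "{base #>\<^bsub>ext_group\<^esub> shift}"] gen by blast
qed

lemma quotient_cyclic: "cyclic_group (ext_group Mod base)"
proof -
  have "base #>\<^bsub>ext_group\<^esub> shift \<in> carrier (ext_group Mod base)"
    using shift_closed by (simp add: carrier_FactGroup del: carrier_ext)
  then show ?thesis
    unfolding cyclic_group_def subgroup_generated_def
    by (intro bexI[of _ "base #>\<^bsub>ext_group\<^esub> shift"]) (simp_all add: quotient_generated)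
qed

lemma embedding_iso: "(\<lambda>y. (y, 0)) \<in> iso N (ext_group\<lparr>carrier := base\<rparr>)"
  by (auto simp: iso_def hom_def base_def bij_betw_def inj_on_def)

lemma realizes_ext_group: "realizes ext_group N n \<tau> v"
  unfolding realizes_def
proof (intro conjI exI)
  show "\<forall>y\<in>carrier N. shift \<otimes>\<^bsub>ext_group\<^esub> (y, 0) \<otimes>\<^bsub>ext_group\<^esub> inv\<^bsub>ext_group\<^esub> shift = (\<tau> y, 0)"
    using shift_conj by blast
qed (rule group_ext base_normal quotient_cyclic order_quotient shift_closed
      quotient_generated embedding_iso shift_pow_n)+

end


section \<open>The Cyclic Extension Theorem\<close>

theorem theorem2:
  fixes N :: "('a, 'b) monoid_scheme"
    and n :: nat and \<tau> :: "'a \<Rightarrow> 'a" and v :: 'a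
  assumes "group N"
    and "extension_type N n \<tau> v"
  shows "\<exists>G :: ('a \<times> nat) monoid. realizes G N n \<tau> v"
  using cyclic_extension.realizes_ext_group[OF cyclic_extension_of_extension_type[OF assms(2)]]
  by blast

end
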